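(* Let $K_1,K_2\in\mathbb{R}\setminus\{0\}$. Up to equivalence, the complete list of critical points of the system $$\left\{\begin{aligned} \dot{\theta}_1&=\tfrac{K_2}{3}\sin(\theta_3-\theta_1)+\tfrac{K_1}{3}\sin(\theta_2-\theta_1)\\ \dot{\theta}_2&=\tfrac{K_2}{3}\sin(\theta_3-\theta_2)+\tfrac{K_1}{3}\sin(\theta_1-\theta_2)\\ \dot{\theta}_3&=\tfrac{K_2}{3}\sin(\theta_1-\theta_3)+\tfrac{K_2}{3}\sin(\theta_2-\theta_3) \end{aligned}\right.$$ is as follows. For all $K_1,K_2\in\mathbb{R}\setminus\{0\}$ there are the four critical points $$\Theta^*_1=(0,\pi,0),\quad \Theta^*_2=(0,\pi,\pi),\quad \Theta^*_3=(0,0,0),\quad \Theta^*_4=(0,0,\pi).$$ In addition, if $\left|\frac{K_2}{2K_1}\right|\le 1$, there are the two more critical points $$\Theta^*_5=\left(0,\,2\arccos\left(-\tfrac{K_2}{2K_1}\right),\,\arccos\left(-\tfrac{K_2}{2K_1}\right)\right),$$ $$\Theta^*_6=\left(0,\,2\pi-2\arccos\left(-\tfrac{K_2}{2K_1}\right),\,2\pi-\arccos\left(-\tfrac{K_2}{2K_1}\right)\right).$$ That is, all the listed points are critical points, and every critical point is equivalent to one of the listed points (to one of $\Theta_1^*,\dots,\Theta_4^*$ if $\left|\frac{K_2}{2K_1}\right|>1$, and to one of $\Theta_1^*,\dots,\Theta_6^*$ if $\left|\frac{K_2}{2K_1}\right|\le 1$).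
   Context: A critical point of the system is a point $\Theta^*=(\theta_1^*,\theta_2^*,\theta_3^* )\in\mathbb{R}^3$ at which the right-hand side of the system vanishes; equivalently $\nabla V(\Theta^* )=0$ with $V(\Theta)=-\frac13[K_2\cos(\theta_3-\theta_1)+K_1\cos(\theta_2-\theta_1)+K_2\cos(\theta_2-\theta_3)]$. The system is invariant under $\Theta\mapsto\Theta+c(1,1,1)$, $c\in\mathbb{R}$, and under $\Theta\mapsto\Theta+2\pi L$, $L\in\mathbb{Z}^3$. Critical points are considered up to equivalence: $\Theta$ and $\Theta'$ are equivalent if $\Theta'=\Theta+c(1,1,1)+2\pi L$ for some $c\in\mathbb{R}$ and $L\in\mathbb{Z}^3$. Here $\arccos:[-1,1]\to[0,\pi]$. *)

theory Defs
  imports "HOL-Analysis.Analysis"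
begin

definition oscillator_rhs :: "real \<Rightarrow> real \<Rightarrow> real^3 \<Rightarrow> real^3" where
  "oscillator_rhs K1 K2 \<Theta> = vector
     [K2 / 3 * sin (\<Theta> $ 3 - \<Theta> $ 1) + K1 / 3 * sin (\<Theta> $ 2 - \<Theta> $ 1),
      K2 / 3 * sin (\<Theta> $ 3 - \<Theta> $ 2) + K1 / 3 * sin (\<Theta> $ 1 - \<Theta> $ 2),
      K2 / 3 * sin (\<Theta> $ 1 - \<Theta> $ 3) + K2 / 3 * sin (\<Theta> $ 2 - \<Theta> $ 3)]"

definition critical_point :: "real \<Rightarrow> real \<Rightarrow> real^3 \<Rightarrow> bool" where
  "critical_point K1 K2 \<Theta> \<longleftrightarrow> oscillator_rhs K1 K2 \<Theta> = 0"

definition phase_equiv :: "real^3 \<Rightarrow> real^3 \<Rightarrow> bool" where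
  "phase_equiv \<Theta> \<Theta>' \<longleftrightarrow>
     (\<exists>(c::real) (L::int^3).
        \<Theta>' = \<Theta> + c *\<^sub>R vector [1, 1, 1] + (2 * pi) *\<^sub>R (\<chi> i. of_int (L $ i)))"

definition Theta1 :: "real^3" where "Theta1 = vector [0, pi, 0]"
definition Theta2 :: "real^3" where "Theta2 = vector [0, pi, pi]"
definition Theta3 :: "real^3" where "Theta3 = vector [0, 0, 0]"
definition Theta4 :: "real^3" where "Theta4 = vector [0, 0, pi]"

text \<open>\<^const>\<open>arccos\<close> takes its usual values in \<open>[0, pi]\<close> only on \<open>[-1, 1]\<close>; the next two
  points are meaningful only if \<open>\<bar>K2 / (2 * K1)\<bar> \<le> 1\<close>.\<close>

definition Theta5 :: "real \<Rightarrow> real \<Rightarrow> real^3" where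
  "Theta5 K1 K2 = vector
     [0, 2 * arccos (- (K2 / (2 * K1))), arccos (- (K2 / (2 * K1)))]"

definition Theta6 :: "real \<Rightarrow> real \<Rightarrow> real^3" where
  "Theta6 K1 K2 = vector
     [0, 2 * pi - 2 * arccos (- (K2 / (2 * K1))), 2 * pi - arccos (- (K2 / (2 * K1)))]"

end

(* With a = Theta$3 - Theta$1 and d = Theta$2 - Theta$1 the equations say sin (d - a) = sin a and
   K2 sin a + K1 sin d = 0.  The first leaves cos (d - a) = cos a or cos (d - a) = - cos a, that is
   d = 2 a or d = pi modulo 2 pi.  If d = pi, the second equation gives sin a = 0; if d = 2 a, it reads
   sin a (K2 + 2 K1 cos a) = 0. *)
theory Submission
  imports Defs
begin

text \<open>The third component, divided by \<open>K2 / 3\<close>, gives the first equation; the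
  first component gives the second. The three components sum to zero by oddness of sine, so the
  remaining one vanishes with these two.\<close>

lemma critical_point_iff:
  assumes "K2 \<noteq> 0"
  shows "critical_point K1 K2 \<Theta> \<longleftrightarrow>
    sin (\<Theta>$2 - \<Theta>$3) = sin (\<Theta>$3 - \<Theta>$1) \<and>
    K2 * sin (\<Theta>$3 - \<Theta>$1) + K1 * sin (\<Theta>$2 - \<Theta>$1) = 0"
proof -
  have "sin (\<Theta>$3 - \<Theta>$2) = - sin (\<Theta>$2 - \<Theta>$3)" "sin (\<Theta>$1 - \<Theta>$2) = - sin (\<Theta>$2 - \<Theta>$1)"
    "sin (\<Theta>$1 - \<Theta>$3) = - sin (\<Theta>$3 - \<Theta>$1)"
    by (simp_all flip: sin_minus)
  moreover have "K2 / 3 * - sin (\<Theta>$3 - \<Theta>$1) + K2 / 3 * sin (\<Theta>$2 - \<Theta>$3) = 0 \<longleftrightarrow>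
      sin (\<Theta>$2 - \<Theta>$3) = sin (\<Theta>$3 - \<Theta>$1)"
    using assms by (auto simp: field_simps)
  ultimately show ?thesis
    unfolding critical_point_def oscillator_rhs_def vec_eq_iff forall_3
    by (auto simp: field_simps)
qed

text \<open>Up to a common shift, a point is given by its phase differences to the first oscillator,
  and sine and cosine together determine each difference modulo \<open>2 * pi\<close>. Equivalence
  thus reduces to trigonometric identities.\<close>

lemma phase_equivI:
  fixes \<Theta> \<Theta>' :: "real^3"
  assumes "sin (\<Theta>'$2 - \<Theta>'$1) = sin (\<Theta>$2 - \<Theta>$1)" "cos (\<Theta>'$2 - \<Theta>'$1) = cos (\<Theta>$2 - \<Theta>$1)"
    and "sin (\<Theta>'$3 - \<Theta>'$1) = sin (\<Theta>$3 - \<Theta>$1)" "cos (\<Theta>'$3 - \<Theta>'$1) = cos (\<Theta>$3 - \<Theta>$1)"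
  shows "phase_equiv \<Theta> \<Theta>'"
proof -
  obtain m :: int where m: "\<Theta>'$2 - \<Theta>'$1 = \<Theta>$2 - \<Theta>$1 + 2 * pi * m"
    using assms(1,2) sin_cos_eq_iff by metis
  obtain n :: int where n: "\<Theta>'$3 - \<Theta>'$1 = \<Theta>$3 - \<Theta>$1 + 2 * pi * n"
    using assms(3,4) sin_cos_eq_iff by metis
  \<comment> \<open>The shift aligns the first coordinates, so the first lattice entry is 0.\<close>
  have "\<Theta>' = \<Theta> + (\<Theta>'$1 - \<Theta>$1) *\<^sub>R vector [1, 1, 1]
      + (2 * pi) *\<^sub>R (\<chi> i. of_int ((vector [0, m, n] :: int^3) $ i))"
    using m n by (simp add: vec_eq_iff forall_3)
  then show ?thesis
    unfolding phase_equiv_def by blast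
qed

text \<open>The cases record sines and cosines rather than angles modulo \<open>2 * pi\<close>, the
  form that \<open>phase_equivI\<close> takes.\<close>

lemma sin_cos_cases:
  fixes a d k l :: real
  assumes "k \<noteq> 0" "l \<noteq> 0" and eq1: "sin (d - a) = sin a" and eq2: "l * sin a + k * sin d = 0"
  obtains (antipodal) "sin d = 0" "cos d = - 1" "sin a = 0"
  | (aligned) "sin d = 0" "cos d = 1" "sin a = 0"
  | (arccos) "cos a = - (l / (2 * k))" "sin d = sin (2 * a)" "cos d = cos (2 * a)"
proof -
  have "(cos (d - a))\<^sup>2 = (cos a)\<^sup>2"
    using eq1 by (simp add: cos_squared_eq)
  then consider "cos (d - a) = cos a" | "cos (d - a) = - cos a"
    by (auto simp: power2_eq_iff)
  then show thesis
  proof cases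
    case 1
    \<comment> \<open>Both \<open>d = a + (d - a)\<close> and \<open>2 * a = a + a\<close> are
      expanded by the addition formulas; \<open>d - a\<close> has the sine and cosine of
      \<open>a\<close>.\<close>
    have s: "sin d = sin (2 * a)" and c: "cos d = cos (2 * a)"
      using sin_add[of a "d - a"] cos_add[of a "d - a"] sin_add[of a a] cos_add[of a a] eq1 1
      by simp_all
    have "sin a * (l + 2 * k * cos a) = 0"
      using eq2 unfolding s sin_double by algebra
    then consider "sin a = 0" | "l + 2 * k * cos a = 0" by auto
    then show thesis
    proof cases
      case 1
      then show thesis using aligned s c by (simp add: sin_double cos_double_sin)
    next
      case 2
      then have "cos a = - (l / (2 * k))" using \<open>k \<noteq> 0\<close> by (simp add: field_simps)
      then show thesis using arccos s c by blast
    qed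
  next
    case 2
    have "sin d = 0"
      using sin_add[of a "d - a"] eq1 2 by simp
    moreover have "cos d = - 1"
    proof -
      have "cos d = - (cos a * cos a + sin a * sin a)"
        using cos_add[of a "d - a"] eq1 2 by (simp del: sin_cos_squared_add3)
      then show ?thesis by (simp only: sin_cos_squared_add3)
    qed
    \<comment> \<open>As \<open>sin d = 0\<close>, the second equation reduces to
      \<open>l * sin a = 0\<close>.\<close>
    ultimately show thesis
      using antipodal eq2 \<open>l \<noteq> 0\<close> by simp
  qed
qed

lemma sin_eq_0_cos_cases:
  fixes x :: real
  assumes "sin x = 0"
  obtains "cos x = 1" | "cos x = - 1"
  using sin_zero_abs_cos_one[OF assms] by linarith

theorem lemma1:
  fixes K1 K2 :: real
  assumes "K1 \<noteq> 0" and "K2 \<noteq> 0"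
  shows "(\<forall>\<Theta> \<in> {Theta1, Theta2, Theta3, Theta4}. critical_point K1 K2 \<Theta>)
    \<and> (\<bar>K2 / (2 * K1)\<bar> \<le> 1 \<longrightarrow>
         (\<forall>\<Theta> \<in> {Theta5 K1 K2, Theta6 K1 K2}. critical_point K1 K2 \<Theta>))
    \<and> (\<bar>K2 / (2 * K1)\<bar> > 1 \<longrightarrow>
         (\<forall>\<Theta>. critical_point K1 K2 \<Theta> \<longrightarrow>
           (\<exists>\<Theta>' \<in> {Theta1, Theta2, Theta3, Theta4}. phase_equiv \<Theta> \<Theta>')))
    \<and> (\<bar>K2 / (2 * K1)\<bar> \<le> 1 \<longrightarrow>
         (\<forall>\<Theta>. critical_point K1 K2 \<Theta> \<longrightarrow>
           (\<exists>\<Theta>' \<in> {Theta1, Theta2, Theta3, Theta4, Theta5 K1 K2, Theta6 K1 K2}.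
              phase_equiv \<Theta> \<Theta>')))"
proof -
  let ?q = "- (K2 / (2 * K1))"
  define A where "A = arccos ?q"
  note crit = critical_point_iff[OF assms(2), of K1]
  note points = Theta1_def Theta2_def Theta3_def Theta4_def Theta5_def Theta6_def
  have listed: "critical_point K1 K2 \<Theta>" if "\<Theta> \<in> {Theta1, Theta2, Theta3, Theta4}" for \<Theta>
    using that by (auto simp: crit points)
  have listed_arccos: "critical_point K1 K2 \<Theta>"
    if q: "\<bar>K2 / (2 * K1)\<bar> \<le> 1" and "\<Theta> \<in> {Theta5 K1 K2, Theta6 K1 K2}" for \<Theta>
  proof -
    have "cos A = ?q" unfolding A_def using q by (intro cos_arccos_abs) simp
    then have "K2 + 2 * K1 * cos A = 0"
      using assms(1) by simp
    \<comment> \<open>This is the second equation at \<open>Theta5\<close>. At \<open>Theta6\<close>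
      both phase differences are negated modulo \<open>2 * pi\<close>, so the left-hand side only
      changes sign.\<close>
    then have "K2 * sin A + K1 * sin (2 * A) = 0"
      unfolding sin_double by algebra
    then show ?thesis
      using that(2) by (auto simp: crit points simp flip: A_def)
  qed
  \<comment> \<open>Keeping the bound inside the second disjunct lets one statement serve both
    regimes: it rules that disjunct out when the ratio exceeds 1.\<close>
  have complete: "(\<exists>\<Theta>' \<in> {Theta1, Theta2, Theta3, Theta4}. phase_equiv \<Theta> \<Theta>') \<or>
      \<bar>K2 / (2 * K1)\<bar> \<le> 1 \<and> (\<exists>\<Theta>' \<in> {Theta5 K1 K2, Theta6 K1 K2}. phase_equiv \<Theta> \<Theta>')"
    if "critical_point K1 K2 \<Theta>" for \<Theta>
  proof -
    define a d where "a = \<Theta>$3 - \<Theta>$1" and "d = \<Theta>$2 - \<Theta>$1"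
    have "sin (d - a) = sin a" "K2 * sin a + K1 * sin d = 0"
      using that by (simp_all add: crit a_def d_def)
    with assms show ?thesis
    proof (cases rule: sin_cos_cases)
      case antipodal
      \<comment> \<open>Here \<open>d\<close> is \<open>pi\<close>, and the sign of
        \<open>cos a\<close> tells \<open>a = 0\<close> from \<open>a = pi\<close> modulo
        \<open>2 * pi\<close>.\<close>
      from antipodal(3) have "phase_equiv \<Theta> Theta1 \<or> phase_equiv \<Theta> Theta2"
      proof (cases rule: sin_eq_0_cos_cases)
        case 1
        then have "phase_equiv \<Theta> Theta1"
          using antipodal by (intro phase_equivI) (simp_all add: points a_def d_def)
        then show ?thesis ..
      next
        case 2
        then have "phase_equiv \<Theta> Theta2"
          using antipodal by (intro phase_equivI) (simp_all add: points a_def d_def)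
        then show ?thesis ..
      qed
      then show ?thesis by blast
    next
      case aligned
      from aligned(3) have "phase_equiv \<Theta> Theta3 \<or> phase_equiv \<Theta> Theta4"
      proof (cases rule: sin_eq_0_cos_cases)
        case 1
        then have "phase_equiv \<Theta> Theta3"
          using aligned by (intro phase_equivI) (simp_all add: points a_def d_def)
        then show ?thesis ..
      next
        case 2
        then have "phase_equiv \<Theta> Theta4"
          using aligned by (intro phase_equivI) (simp_all add: points a_def d_def)
        then show ?thesis ..
      qed
      then show ?thesis by blast
    next
      case arccos
      \<comment> \<open>The ratio is \<open>- cos a\<close>, so this case arises only where
        \<open>arccos\<close> has its usual meaning.\<close>
      have q: "\<bar>K2 / (2 * K1)\<bar> \<le> 1"
        using arccos(1) abs_cos_le_one[of a] by simp
      then have cosA: "cos A = cos a"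
        unfolding A_def using arccos(1) cos_arccos_abs[of ?q] by simp
      \<comment> \<open>Equal cosines leave \<open>a = A\<close> or \<open>a = - A\<close> modulo
        \<open>2 * pi\<close>; these give \<open>Theta5\<close> and \<open>Theta6\<close>.\<close>
      then have "(sin A)\<^sup>2 = (sin a)\<^sup>2"
        by (simp add: sin_squared_eq)
      then consider "sin A = sin a" | "sin A = - sin a"
        by (auto simp: power2_eq_iff)
      then have "phase_equiv \<Theta> (Theta5 K1 K2) \<or> phase_equiv \<Theta> (Theta6 K1 K2)"
      proof cases
        case 1
        then have "phase_equiv \<Theta> (Theta5 K1 K2)"
          using arccos(2,3) cosA
          by (intro phase_equivI)
            (simp_all add: points sin_double cos_double flip: a_def d_def A_def)
        then show ?thesis ..
      next
        case 2
        then have "phase_equiv \<Theta> (Theta6 K1 K2)"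
          using arccos(2,3) cosA
          by (intro phase_equivI)
            (simp_all add: points sin_double cos_double
              flip: a_def d_def A_def)
        then show ?thesis ..
      qed
      then show ?thesis using q by blast
    qed
  qed
  show ?thesis
  proof (intro conjI impI allI ballI)
    fix \<Theta> assume "\<bar>K2 / (2 * K1)\<bar> > 1" "critical_point K1 K2 \<Theta>"
    with complete[of \<Theta>] show "\<exists>\<Theta>' \<in> {Theta1, Theta2, Theta3, Theta4}. phase_equiv \<Theta> \<Theta>'"
      by linarith
  next
    fix \<Theta> assume "critical_point K1 K2 \<Theta>"
    with complete[of \<Theta>] show "\<exists>\<Theta>' \<in> {Theta1, Theta2, Theta3, Theta4, Theta5 K1 K2, Theta6 K1 K2}.
        phase_equiv \<Theta> \<Theta>'"
      by blast
  qed (use listed listed_arccos in blast)+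
qed

end
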